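(* There exists a sequence $g_n\colon\mathbb{D}\to\mathbb{D}$, $n\in\mathbb{N}$, of inner functions with $g_n(0)=0$ such that, writing $G_n = g_n\circ\cdots\circ g_1$ for $n\ge 1$ and $G_m^n = g_n\circ\cdots\circ g_{m+1}$ for $n>m\ge 0$, the following hold: (1) $G_n\to0$ locally uniformly in $\mathbb{D}$ as $n\to\infty$; (2) for every pair of integers $m\ge0$ and $\ell\ge1$, $\displaystyle\lim_{N\to+\infty}\frac1N\sum_{n=m+1}^{N}\left((G_m^n)'(0)\right)^\ell=0$; (3) the sequence $\{\widehat G_n\}_{n\in\mathbb{N}}$ is not ergodic.
   Context: $\mathbb{D}$ is the open unit disc in $\mathbb{C}$, $m$ (as a measure) is normalised Lebesgue measure on $\partial\mathbb{D}$, and $\mathbb{N}=\{1,2,3,\dots\}$. An analytic map $g\colon\mathbb{D}\to\mathbb{D}$ is inner if $\hat g(e^{i\theta})=\lim_{r\nearrow 1}g(re^{i\theta})$ exists and has modulus one for almost every $e^{i\theta}\in\partial\mathbb{D}$; $\hat g$ is its (a.e. defined) boundary map. If $g(0)=0$, then $\hat g$ preserves $m$. A sequence $\{T_n\}_{n\in\mathbb{N}}$ of measure-preserving maps of a probability space $(X,\mathcal{A},\mu)$ is called ergodic if $\lim_{N\to\infty}\left\|\frac1N\sum_{n=1}^N\varphi\circ T_n-\int_X\varphi\,d\mu\right\|_{2}=0$ for every complex-valued $\varphi\in L^2(\mu)$. For boundary maps this is applied with $(X,\mu)=(\partial\mathbb{D},m)$. *)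

theory Defs
  imports "HOL-Probability.Probability" "HOL-Complex_Analysis.Complex_Analysis"
begin

text \<open>The completion makes the measurable sets the Lebesgue (not only the Borel) subsets of the
  circle.\<close>

definition circle_measure :: "complex measure" where
  "circle_measure =
     completion (distr (uniform_measure lborel {0..2 * pi}) (restrict_space borel (sphere 0 1)) cis)"

lemma space_circle_measure: "space circle_measure = sphere 0 1"
  by (simp add: circle_measure_def space_restrict_space)

lemma prob_space_circle_measure: "prob_space circle_measure"
proof -
  have "prob_space (uniform_measure lborel {0..2 * pi})"
    by (rule prob_space_uniform_measure) auto
  moreover have "cis \<in> borel_measurable borel"
    by (intro borel_measurable_continuous_onI continuous_on_cis continuous_on_id)
  then have "cis \<in> uniform_measure lborel {0..2 * pi} \<rightarrow>\<^sub>M restrict_space borel (sphere 0 1)"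
    by (intro measurable_restrict_space2) (auto cong: measurable_cong_sets)
  ultimately have "prob_space (distr (uniform_measure lborel {0..2 * pi})
      (restrict_space borel (sphere 0 1)) cis)"
    by (rule prob_space.prob_space_distr)
  then show ?thesis
    unfolding circle_measure_def by (rule prob_space.prob_space_completion)
qed

definition has_radial_limit :: "(complex \<Rightarrow> complex) \<Rightarrow> complex \<Rightarrow> complex \<Rightarrow> bool" where
  "has_radial_limit g \<zeta> l \<longleftrightarrow> ((\<lambda>r::real. g (of_real r * \<zeta>)) \<longlongrightarrow> l) (at_left 1)"

definition inner_function :: "(complex \<Rightarrow> complex) \<Rightarrow> bool" where
  "inner_function g \<longleftrightarrow>
     g holomorphic_on ball 0 1 \<and> g ` ball 0 1 \<subseteq> ball 0 1 \<and>
     (AE \<zeta> in circle_measure. \<exists>l. norm l = 1 \<and> has_radial_limit g \<zeta> l)"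

text \<open>For an inner function the first branch is taken almost everywhere; the value \<open>1\<close> on the
  exceptional null set is arbitrary and makes the map a total self-map of the circle.\<close>

definition boundary_map :: "(complex \<Rightarrow> complex) \<Rightarrow> complex \<Rightarrow> complex" where
  "boundary_map g \<zeta> =
     (if \<exists>l. norm l = 1 \<and> has_radial_limit g \<zeta> l then THE l. has_radial_limit g \<zeta> l else 1)"

text \<open>\<open>forward_comp g m n\<close> is \<open>g n \<circ> \<dots> \<circ> g (m + 1)\<close> for \<open>n > m\<close>, so that \<open>forward_comp g 0 n\<close> is
  \<open>g n \<circ> \<dots> \<circ> g 1\<close>. The value \<open>g 0\<close> is never used.\<close>

definition forward_comp :: "(nat \<Rightarrow> complex \<Rightarrow> complex) \<Rightarrow> nat \<Rightarrow> nat \<Rightarrow> complex \<Rightarrow> complex" where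
  "forward_comp g m n = fold g [Suc m..<Suc n]"

lemma forward_comp_self: "forward_comp g m m = id"
  by (simp add: forward_comp_def)

lemma forward_comp_Suc: "m \<le> n \<Longrightarrow> forward_comp g m (Suc n) = g (Suc n) \<circ> forward_comp g m n"
  by (simp add: forward_comp_def)

definition square_integrable :: "'a measure \<Rightarrow> ('a \<Rightarrow> complex) \<Rightarrow> bool" where
  "square_integrable M \<phi> \<longleftrightarrow> \<phi> \<in> borel_measurable M \<and> integrable M (\<lambda>x. (norm (\<phi> x))\<^sup>2)"

definition L2_norm_on :: "'a measure \<Rightarrow> ('a \<Rightarrow> complex) \<Rightarrow> real" where
  "L2_norm_on M f = sqrt (LINT x|M. (norm (f x))\<^sup>2)"

text \<open>The notion is meant for a probability space \<open>M\<close> and maps \<open>T n\<close>, \<open>n \<ge> 1\<close>, that preserve \<open>M\<close>.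
  These presuppositions are deliberately not conjuncts: the negation of \<open>ergodic_sequence\<close> is
  failure of the mean convergence, never failure of measure preservation.\<close>

definition ergodic_sequence :: "'a measure \<Rightarrow> (nat \<Rightarrow> 'a \<Rightarrow> 'a) \<Rightarrow> bool" where
  "ergodic_sequence M T \<longleftrightarrow>
     (\<forall>\<phi>. square_integrable M \<phi> \<longrightarrow>
        (\<lambda>N. L2_norm_on M (\<lambda>x. (\<Sum>n=1..N. \<phi> (T n x)) / of_nat N - (LINT y|M. \<phi> y)))
          \<longlonglongrightarrow> 0)"

end

theory Submission
  imports Defs
begin

text \<open>Let \<open>g\<^sub>n\<close> be \<open>z \<mapsto> z\<^sup>2\<close> when \<open>n\<close> is a power of \<open>4\<close> and the identity otherwise, so that
  \<open>G\<^sub>n\<close> is a monomial that stays constant on each block \<open>4\<^sup>k \<le> n < 4\<^sup>k\<^sup>+\<^sup>1\<close>. The exponents tend to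
  infinity, and \<open>(G\<^sub>m\<^sup>n)'(0)\<close> vanishes as soon as one squaring lies between \<open>m\<close> and \<open>n\<close>.
  But the last block fills more than three quarters of \<open>{1, \<dots>, 4\<^sup>k\<^sup>+\<^sup>1 - 1}\<close>, so at these times the average of
  \<open>\<phi>(\<zeta>) = \<zeta>\<close> has modulus at least \<open>1/2\<close> everywhere on the circle, while \<open>\<phi>\<close> has mean \<open>0\<close>.\<close>

section \<open>Compositions and boundary maps of monomials\<close>

lemma forward_comp_monomials:
  assumes "m \<le> n"
  shows "forward_comp (\<lambda>i z. z ^ a i) m n = (\<lambda>z. z ^ (\<Prod>i=Suc m..n. a i))"
  using assms
proof (induction n rule: dec_induct)
  case base
  show ?case by (simp add: forward_comp_self id_def)
next
  case (step n)
  then show ?case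
    by (simp add: forward_comp_Suc comp_def flip: power_mult)
qed

lemma has_radial_limit_power: "has_radial_limit (\<lambda>z. z ^ p) \<zeta> (\<zeta> ^ p)"
  unfolding has_radial_limit_def by (auto intro!: tendsto_eq_intros)

lemma has_radial_limit_unique:
  "has_radial_limit g \<zeta> l \<Longrightarrow> has_radial_limit g \<zeta> l' \<Longrightarrow> l = l'"
  unfolding has_radial_limit_def by (rule tendsto_unique[rotated]) auto

text \<open>Monomials are continuous on the whole plane, so the radial limit exists, with modulus
  one, at every point of the circle, and the default value \<open>1\<close> of
  \<open>boundary_map\<close> never enters.\<close>

lemma boundary_map_power:
  assumes "norm \<zeta> = 1"
  shows "boundary_map (\<lambda>z. z ^ p) \<zeta> = \<zeta> ^ p"
proof -
  have "\<exists>l. norm l = 1 \<and> has_radial_limit (\<lambda>z. z ^ p) \<zeta> l"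
    using assms has_radial_limit_power[of p \<zeta>] by (intro exI[of _ "\<zeta> ^ p"]) (simp add: norm_power)
  moreover have "(THE l. has_radial_limit (\<lambda>z. z ^ p) \<zeta> l) = \<zeta> ^ p"
    using has_radial_limit_power has_radial_limit_unique by blast
  ultimately show ?thesis
    by (simp add: boundary_map_def)
qed

lemma inner_function_power:
  assumes "p \<ge> 1"
  shows "inner_function (\<lambda>z. z ^ p)"
  unfolding inner_function_def
proof (intro conjI AE_I2)
  show "(\<lambda>z::complex. z ^ p) holomorphic_on ball 0 1"
    by (intro holomorphic_intros)
  show "(\<lambda>z::complex. z ^ p) ` ball 0 1 \<subseteq> ball 0 1"
    using assms by (auto simp: norm_power power_less_one_iff)
next
  fix \<zeta> assume "\<zeta> \<in> space circle_measure"
  then show "\<exists>l. norm l = 1 \<and> has_radial_limit (\<lambda>z. z ^ p) \<zeta> l"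
    using has_radial_limit_power[of p \<zeta>]
    by (intro exI[of _ "\<zeta> ^ p"]) (simp add: norm_power space_circle_measure)
qed

section \<open>Integration over the circle\<close>

lemma measurable_circle_measure:
  "f \<in> borel_measurable borel \<Longrightarrow> f \<in> borel_measurable circle_measure"
  unfolding circle_measure_def
  by (intro measurable_completion) (auto intro!: measurable_restrict_space1 cong: measurable_cong_sets)

text \<open>Pulled back along \<open>cis\<close>, the mean becomes an integral of \<open>cis\<close>
  over a full period. It vanishes because the antiderivative \<open>- \<i> * cis t\<close> takes
  equal values at both endpoints.\<close>

lemma integral_circle_measure_id: "(LINT \<zeta>|circle_measure. \<zeta>) = 0"
proof -
  let ?U = "uniform_measure lborel {0..2 * pi}"
  have cis_meas: "cis \<in> borel_measurable borel"
    by (intro borel_measurable_continuous_onI continuous_on_cis continuous_on_id)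
  have cis: "cis \<in> ?U \<rightarrow>\<^sub>M restrict_space borel (sphere 0 1)"
    using cis_meas by (intro measurable_restrict_space2) (auto cong: measurable_cong_sets)
  have id_meas: "(\<lambda>\<zeta>. \<zeta>) \<in> borel_measurable (restrict_space borel (sphere (0::complex) 1))"
    by (intro measurable_restrict_space1) auto
  have cis_int: "(LINT t|lborel. indicator {0..2*pi} t *\<^sub>R cis t) = 0"
  proof -
    have "((\<lambda>t. - \<i> * cis t) has_vector_derivative cis t) (at t within A)" for t A
      unfolding cis_conv_exp
      by (rule has_vector_derivative_real_field) (auto intro!: derivative_eq_intros simp: mult.assoc)
    then have "(LINT t|lborel. indicator {0..2*pi} t *\<^sub>R cis t) = - \<i> * cis (2*pi) - - \<i> * cis 0"
      by (intro integral_FTC_Icc) (auto intro!: continuous_intros)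
    then show ?thesis by simp
  qed
  \<comment> \<open>The normalisation is moved from \<open>ennreal\<close> into a real-valued
    density, the form that \<open>integral_density\<close> expects.\<close>
  have U: "?U = density lborel (\<lambda>t. ennreal (indicator {0..2*pi} t / (2*pi)))"
    unfolding uniform_measure_def
    by (intro density_cong AE_I2) (auto simp flip: divide_ennreal split: split_indicator)
  have "(LINT \<zeta>|circle_measure. \<zeta>) = (LINT t|?U. cis t)"
    unfolding circle_measure_def
    using id_meas by (simp add: integral_completion integral_distr[OF cis])
  also have "\<dots> = (LINT t|lborel. (indicator {0..2*pi} t / (2*pi)) *\<^sub>R cis t)"
    using cis_meas by (simp add: U integral_density)
  also have "\<dots> = (1 / (2*pi)) *\<^sub>R (LINT t|lborel. indicator {0..2*pi} t *\<^sub>R cis t)"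
    by (subst integral_scaleR_right[symmetric]) (simp add: field_simps)
  finally show ?thesis
    by (simp add: cis_int)
qed

section \<open>Growth and stagnation of the exponents\<close>

definition exponent :: "nat \<Rightarrow> nat" where
  "exponent i = (if i \<in> range ((^) 4) then 2 else 1)"

lemma exponent_ge_1: "exponent i \<ge> 1"
  by (simp add: exponent_def)

text \<open>The shorter product divides the longer one, which is positive.\<close>

lemma prod_exponent_mono:
  assumes "n \<le> n'"
  shows "(\<Prod>i=Suc m..n. exponent i) \<le> (\<Prod>i=Suc m..n'. exponent i)"
  using assms exponent_ge_1
  by (intro dvd_imp_le prod_dvd_prod_subset prod_pos) (auto simp: Suc_le_eq)

text \<open>Passing from \<open>4 ^ k\<close> to \<open>4 ^ Suc k\<close> gains the factor
  \<open>2\<close> at the new endpoint. Since \<open>1 = 4 ^ 0\<close> is itself a squaring index,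
  the product is in fact \<open>2 ^ Suc k\<close>; the weaker bound suffices for divergence.\<close>

lemma two_power_le_prod_exponent: "2 ^ k \<le> (\<Prod>i=Suc 0..4 ^ k. exponent i)"
proof (induction k)
  case (Suc k)
  have "(\<Prod>i=Suc 0..4 ^ Suc k. exponent i)
      = (\<Prod>i=Suc 0..4 ^ Suc k - 1. exponent i) * exponent (4 ^ Suc k)"
    using prod.nat_ivl_Suc'[of "Suc 0" "4 ^ Suc k - 1" exponent] by (simp add: mult.commute)
  moreover have "exponent (4 ^ Suc k) = 2"
    unfolding exponent_def by (metis rangeI)
  moreover have "(4::nat) ^ k \<le> 4 ^ Suc k - 1"
    by simp
  then have "2 ^ k \<le> (\<Prod>i=Suc 0..4 ^ Suc k - 1. exponent i)"
    using Suc prod_exponent_mono le_trans by blast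
  ultimately show ?case by simp
qed (use exponent_ge_1 in auto)

lemma filterlim_prod_exponent: "filterlim (\<lambda>n. \<Prod>i=Suc 0..n. exponent i) at_top sequentially"
  unfolding filterlim_at_top eventually_sequentially
proof (intro allI exI impI)
  fix k n :: nat
  assume "4 ^ k \<le> n"
  have "k \<le> 2 ^ k"
    by (simp add: less_imp_le)
  also have "\<dots> \<le> (\<Prod>i=Suc 0..4 ^ k. exponent i)"
    by (rule two_power_le_prod_exponent)
  also have "\<dots> \<le> (\<Prod>i=Suc 0..n. exponent i)"
    using \<open>4 ^ k \<le> n\<close> by (rule prod_exponent_mono)
  finally show "k \<le> (\<Prod>i=Suc 0..n. exponent i)" .
qed

text \<open>No power of \<open>4\<close> lies strictly between \<open>4 ^ k\<close> and
  \<open>4 ^ Suc k\<close>, so the additional factors are all \<open>1\<close>.\<close>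

lemma prod_exponent_block:
  assumes "4 ^ k \<le> n" "n < 4 ^ Suc k"
  shows "(\<Prod>i=Suc 0..n. exponent i) = (\<Prod>i=Suc 0..4 ^ k. exponent i)"
proof (rule prod.mono_neutral_right)
  show "\<forall>i\<in>{Suc 0..n} - {Suc 0..4 ^ k}. exponent i = 1"
  proof
    fix i assume i: "i \<in> {Suc 0..n} - {Suc 0..4 ^ k}"
    have "i \<noteq> 4 ^ j" for j
    proof
      assume "i = 4 ^ j"
      with i assms have "(4::nat) ^ k < 4 ^ j" "(4::nat) ^ j < 4 ^ Suc k" by auto
      then show False
        by (metis less_Suc_eq_le linorder_not_le one_less_numeral_iff power_less_imp_less_exp
            semiring_norm(76) less_le_not_le power_strict_increasing_iff)
    qed
    then show "exponent i = 1"
      by (auto simp: exponent_def)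
  qed
qed (use assms in auto)

text \<open>Because \<open>m < 4 ^ m\<close>, the squaring index \<open>4 ^ m\<close> lies in the
  range of the product. This forces the derivative of the composed monomial at \<open>0\<close> to
  vanish.\<close>

lemma prod_exponent_ge_2:
  assumes "4 ^ m \<le> n"
  shows "(\<Prod>i=Suc m..n. exponent i) \<ge> 2"
proof -
  have "m < 4 ^ m"
    by (simp add: power_gt_expt)
  then have "exponent (4 ^ m) dvd (\<Prod>i=Suc m..n. exponent i)"
    using assms by (intro dvd_prodI) auto
  moreover have "exponent (4 ^ m) = 2"
    unfolding exponent_def by (metis rangeI)
  moreover have "(\<Prod>i=Suc m..n. exponent i) > 0"
    using exponent_ge_1 by (intro prod_pos) (auto simp: Suc_le_eq)
  ultimately show ?thesis
    by (metis dvd_imp_le)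
qed

section \<open>Locally uniform convergence and averages of derivatives\<close>

lemma uniform_limit_power:
  fixes P :: "nat \<Rightarrow> nat"
  assumes "filterlim P at_top sequentially" and "0 \<le> r" "r < 1"
  shows "uniform_limit (cball 0 r) (\<lambda>n z. z ^ P n :: complex) (\<lambda>_. 0) sequentially"
proof (rule uniform_limitI)
  fix e :: real assume "e > 0"
  have "(\<lambda>n. r ^ P n) \<longlonglongrightarrow> 0"
    using filterlim_compose[OF LIMSEQ_power_zero[of r] assms(1)] assms by simp
  then have "\<forall>\<^sub>F n in sequentially. r ^ P n < e"
    using \<open>e > 0\<close> by (auto dest: order_tendstoD)
  then show "\<forall>\<^sub>F n in sequentially. \<forall>z\<in>cball 0 r. dist (z ^ P n) (0::complex) < e"
  proof eventually_elim
    case (elim n)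
    then show ?case
      by (auto simp: norm_power intro: le_less_trans[OF power_mono])
  qed
qed

lemma average_deriv_tendsto_0:
  fixes l :: nat
  assumes "l \<ge> 1"
  shows "(\<lambda>N. (\<Sum>n=m+1..N. (deriv (\<lambda>z::complex. z ^ (\<Prod>i=Suc m..n. exponent i)) 0) ^ l) / of_nat N)
    \<longlonglongrightarrow> 0"
proof -
  let ?d = "\<lambda>n. (deriv (\<lambda>z::complex. z ^ (\<Prod>i=Suc m..n. exponent i)) 0) ^ l"
  have d0: "?d n = 0" if "4 ^ m \<le> n" for n
  proof -
    have "(\<Prod>i=Suc m..n. exponent i) \<ge> 2"
      by (rule prod_exponent_ge_2[OF that])
    then have "deriv (\<lambda>z::complex. z ^ (\<Prod>i=Suc m..n. exponent i)) 0 = 0"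
      by (intro DERIV_imp_deriv) (auto intro!: derivative_eq_intros)
    \<comment> \<open>The hypothesis \<open>l \<ge> 1\<close> matters here, since
      \<open>0 ^ 0 = 1\<close>.\<close>
    then show ?thesis using assms by simp
  qed
  \<comment> \<open>From \<open>N = 4 ^ m\<close> on the sum no longer changes, so the averages are
    a constant divided by \<open>N\<close>.\<close>
  have "\<forall>\<^sub>F N in sequentially. (\<Sum>n=m+1..4 ^ m. ?d n) / of_nat N = (\<Sum>n=m+1..N. ?d n) / of_nat N"
  proof (rule eventually_sequentiallyI)
    fix N :: nat assume "4 ^ m \<le> N"
    then have "(\<Sum>n=m+1..4 ^ m. ?d n) = (\<Sum>n=m+1..N. ?d n)"
      by (intro sum.mono_neutral_left ballI d0) auto
    then show "(\<Sum>n=m+1..4 ^ m. ?d n) / of_nat N = (\<Sum>n=m+1..N. ?d n) / of_nat N"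
      by simp
  qed
  then show ?thesis
    by (rule Lim_transform_eventually[rotated]) (rule lim_const_over_n)
qed

section \<open>Failure of ergodicity\<close>

lemma norm_average_ge_half:
  fixes \<zeta> :: complex
  assumes "norm \<zeta> = 1" and N: "N = 4 ^ Suc k - 1"
  shows "1 / 2 \<le> norm ((\<Sum>n=1..N. \<zeta> ^ (\<Prod>i=Suc 0..n. exponent i)) / of_nat N)"
proof -
  let ?f = "\<lambda>n. \<zeta> ^ (\<Prod>i=Suc 0..n. exponent i)"
  have pos: "(4::nat) ^ k \<ge> 1" by simp
  \<comment> \<open>The second piece consists of \<open>3 * 4 ^ k\<close> equal unimodular terms,
    while the first has fewer than \<open>4 ^ k\<close> terms. At least \<open>2 * 4 ^ k\<close> of
    the modulus survives, against a divisor \<open>N\<close> below \<open>4 * 4 ^ k\<close>.\<close>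
  have split: "{1..N} = {1..<4 ^ k} \<union> {4 ^ k..<4 ^ Suc k}"
    using pos by (auto simp: N)
  have "(\<Sum>n=1..N. ?f n) = (\<Sum>n=1..<4 ^ k. ?f n) + (\<Sum>n=4 ^ k..<4 ^ Suc k. ?f n)"
    unfolding split by (rule sum.union_disjoint) auto
  moreover have "norm (\<Sum>n=1..<4 ^ k. ?f n) \<le> real (4 ^ k)"
  proof -
    have "norm (\<Sum>n=1..<4 ^ k. ?f n) \<le> (\<Sum>n=1..<(4::nat) ^ k. 1)"
      by (rule sum_norm_le) (simp add: norm_power assms)
    then show ?thesis by (simp add: of_nat_diff)
  qed
  moreover have "norm (\<Sum>n=4 ^ k..<4 ^ Suc k. ?f n) = 3 * 4 ^ k"
  proof -
    have "(\<Sum>n=4 ^ k..<4 ^ Suc k. ?f n) = (\<Sum>n=(4::nat) ^ k..<4 ^ Suc k. ?f (4 ^ k))"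
      by (intro sum.cong) (auto simp: prod_exponent_block)
    also have "norm \<dots> = 3 * 4 ^ k"
      by (simp add: norm_mult norm_power assms)
    finally show ?thesis .
  qed
  ultimately have "norm (\<Sum>n=1..N. ?f n) \<ge> 2 * 4 ^ k"
    using norm_diff_ineq[of "\<Sum>n=4 ^ k..<4 ^ Suc k. ?f n" "\<Sum>n=1..<4 ^ k. ?f n"]
    by (simp add: add.commute)
  moreover have "real N \<le> 4 * 4 ^ k"
    by (simp add: N of_nat_diff)
  moreover have "N > 0"
    using pos unfolding N power_Suc by linarith
  ultimately show ?thesis
    by (simp add: norm_divide field_simps)
qed

lemma not_ergodic_boundary_powers:
  "\<not> ergodic_sequence circle_measure (\<lambda>n. boundary_map (\<lambda>z. z ^ (\<Prod>i=Suc 0..n. exponent i)))"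
    (is "\<not> ergodic_sequence _ ?T")
proof
  interpret prob_space circle_measure by (rule prob_space_circle_measure)
  let ?A = "\<lambda>N \<zeta>. (\<Sum>n=1..N. \<zeta> ^ (\<Prod>i=Suc 0..n. exponent i)) / complex_of_nat N"
  let ?L = "\<lambda>N. L2_norm_on circle_measure
    (\<lambda>\<zeta>. (\<Sum>n=1..N. ?T n \<zeta>) / of_nat N - (LINT \<zeta>|circle_measure. \<zeta>))"
  assume "ergodic_sequence circle_measure ?T"
  moreover have "square_integrable circle_measure (\<lambda>\<zeta>. \<zeta>)"
    unfolding square_integrable_def
    by (auto intro!: measurable_circle_measure integrable_const_bound[where B = 1] AE_I2
          simp: space_circle_measure)
  ultimately have "?L \<longlonglongrightarrow> 0"
    unfolding ergodic_sequence_def by blast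
  moreover have "filterlim (\<lambda>k. 4 ^ Suc k - 1 :: nat) sequentially sequentially"
  proof (rule filterlim_at_top_mono[OF filterlim_ident], rule always_eventually, rule allI)
    fix k :: nat
    have "k < 4 ^ k" by (simp add: power_gt_expt)
    then show "k \<le> 4 ^ Suc k - 1" by simp
  qed
  \<comment> \<open>Convergence of the full sequence passes to the ends of the blocks, where the
    averages stay large.\<close>
  ultimately have lim: "(\<lambda>k. ?L (4 ^ Suc k - 1)) \<longlonglongrightarrow> 0"
    by (rule filterlim_compose)
  have "1 / 2 \<le> ?L (4 ^ Suc k - 1)" for k
  proof -
    define N :: nat where "N = 4 ^ Suc k - 1"
    \<comment> \<open>The upper bound serves integrability, which monotonicity of the integral
      requires.\<close>
    have upper: "norm (?A N \<zeta>) \<le> 1" if "norm \<zeta> = 1" for \<zeta>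
    proof -
      have "norm (\<Sum>n=1..N. \<zeta> ^ (\<Prod>i=Suc 0..n. exponent i)) \<le> (\<Sum>n=1..N. 1)"
        by (rule sum_norm_le) (simp add: norm_power that)
      then show ?thesis by (auto simp: norm_divide divide_le_eq_1)
    qed
    have lower: "1 / 2 \<le> norm (?A N \<zeta>)" if "norm \<zeta> = 1" for \<zeta>
      by (rule norm_average_ge_half[OF that N_def])
    have meas: "(\<lambda>\<zeta>. (norm (?A N \<zeta>))\<^sup>2) \<in> borel_measurable circle_measure"
      by (intro measurable_circle_measure) measurable
    have int: "integrable circle_measure (\<lambda>\<zeta>. (norm (?A N \<zeta>))\<^sup>2)"
      using upper
      by (intro integrable_const_bound[where B = 1] AE_I2 meas)
        (simp add: space_circle_measure power_le_one)
    have "(LINT \<zeta>|circle_measure. (1 / 2)\<^sup>2) \<le> (LINT \<zeta>|circle_measure. (norm (?A N \<zeta>))\<^sup>2)"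
      using lower by (intro integral_mono int power_mono) (auto simp: space_circle_measure)
    \<comment> \<open>Total mass one carries the pointwise bound over to the integral
      unchanged.\<close>
    then have "(1 / 2)\<^sup>2 \<le> (LINT \<zeta>|circle_measure. (norm (?A N \<zeta>))\<^sup>2)"
      by (simp add: prob_space)
    also have "\<dots> = (LINT \<zeta>|circle_measure. (norm ((\<Sum>n=1..N. ?T n \<zeta>) / of_nat N
        - (LINT \<zeta>|circle_measure. \<zeta>)))\<^sup>2)"
      by (intro Bochner_Integration.integral_cong refl)
        (simp add: space_circle_measure boundary_map_power integral_circle_measure_id)
    finally show ?thesis
      unfolding L2_norm_on_def N_def by (intro real_le_rsqrt)
  qed
  then have "1 / 2 \<le> (0::real)"
    by (intro tendsto_lowerbound[OF lim]) auto
  then show False by simp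
qed

theorem proposition6p1:
  "\<exists>g :: nat \<Rightarrow> complex \<Rightarrow> complex.
     (\<forall>n\<ge>1. inner_function (g n) \<and> g n 0 = 0) \<and>
     (\<forall>z\<in>ball 0 1. \<exists>d>0. cball z d \<subseteq> ball 0 1 \<and>
        uniform_limit (cball z d) (\<lambda>n. forward_comp g 0 n) (\<lambda>_. 0) sequentially) \<and>
     (\<forall>m. \<forall>l\<ge>1.
        (\<lambda>N. (\<Sum>n=m+1..N. (deriv (forward_comp g m n) 0) ^ l) / of_nat N) \<longlonglongrightarrow> 0) \<and>
     \<not> ergodic_sequence circle_measure (\<lambda>n. boundary_map (forward_comp g 0 n))"
proof (rule exI[of _ "\<lambda>i z. z ^ exponent i"], intro conjI allI impI ballI)
  let ?g = "\<lambda>i (z::complex). z ^ exponent i"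
  show "inner_function (?g n)" for n
    by (intro inner_function_power exponent_ge_1)
  show "(0::complex) ^ exponent n = 0" for n
    using exponent_ge_1[of n] by simp
  show "\<not> ergodic_sequence circle_measure (\<lambda>n. boundary_map (forward_comp ?g 0 n))"
    using not_ergodic_boundary_powers by (simp add: forward_comp_monomials)
  show "(\<lambda>N. (\<Sum>n=m+1..N. (deriv (forward_comp ?g m n) 0) ^ l) / of_nat N) \<longlonglongrightarrow> 0"
    if "l \<ge> 1" for m l
    using average_deriv_tendsto_0[OF that, of m] by (simp add: forward_comp_monomials)
  show "\<exists>d>0. cball z d \<subseteq> ball 0 1 \<and>
      uniform_limit (cball z d) (forward_comp ?g 0) (\<lambda>_. 0) sequentially"
    if "z \<in> ball 0 1" for z
  proof (intro exI conjI)
    \<comment> \<open>Half the distance from \<open>z\<close> to the unit circle; the disc around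
      \<open>z\<close> then lies in a centred closed disc of radius
      \<open>?r = (1 + norm z) / 2 < 1\<close>.\<close>
    let ?d = "(1 - norm z) / 2"
    let ?r = "norm z + ?d"
    show "?d > 0" using that by simp
    have r: "0 \<le> ?r" "?r < 1"
      using that norm_ge_zero[of z] by (auto simp: field_simps)
    have sub: "cball z ?d \<subseteq> cball 0 ?r"
      by (simp add: cball_subset_cball_iff)
    then show "cball z ?d \<subseteq> ball 0 1"
      using r by auto
    show "uniform_limit (cball z ?d) (\<lambda>n. forward_comp ?g 0 n) (\<lambda>_. 0) sequentially"
      using uniform_limit_on_subset[OF uniform_limit_power[OF filterlim_prod_exponent r] sub]
      by (simp add: forward_comp_monomials)
  qed
qed

end
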